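(* Let $G$ be a finite group, $k$ a field, and $V$ a finite-dimensional faithful representation of $G$ over $k$. Assume that the characteristic of $k$ does not divide $|G|$. Then $$\beta_{\mathrm{field}}(G,V) \leq 2\,D_{\mathrm{span}}(G,V) + 1.$$
   Context: $k[V]$ is the ring of polynomial functions on $V$ (the symmetric algebra of $V^*$), graded by degree, with $G$-action $(gf)(v)=f(g^{-1}v)$; $k(V)$ is its fraction field; $k[V]^G$ and $k(V)^G$ are the $G$-invariants. $k[V]_{\le d}$ is the space of polynomials of degree at most $d$, and $k[V]^G_{\leq d}$ its subspace of invariants. The field Noether number $\beta_{\mathrm{field}}(G,V)$ is the minimum $d\in\mathbb{N}=\{0,1,2,\dots\}$ such that $k(V)^G$ is generated, as a field extension of $k$, by $k[V]^G_{\le d}$. The spanning degree $D_{\mathrm{span}}(G,V)$ is the minimum $d\in\mathbb{N}$ such that $k[V]_{\le d}$ spans $k(V)$ as a vector space over $k(V)^G$. *)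

theory Defs
  imports
    "HOL-Computational_Algebra.Fraction_Field"
    "HOL-Algebra.Algebraic_Closure_Type"
    "HOL-Algebra.Generated_Fields"
    "HOL-Algebra.Group_Action"
    "HOL-Library.Poly_Mapping"
begin

section \<open>Polynomials and rational functions\<close>

text \<open>
  A polynomial is a formal one: a finitely supported map from monomials to coefficients, a
  monomial being the finitely supported map from variables to their exponents. Over a finite
  field this is not the same as a polynomial map. The variables are indexed by all natural
  numbers; the ring in the first n of them is singled out by a set below.
\<close>

type_synonym 'k mpoly = "(nat \<Rightarrow>\<^sub>0 nat) \<Rightarrow>\<^sub>0 'k"

definition Const :: "'k::comm_ring_1 \<Rightarrow> 'k mpoly" where
  "Const a = Poly_Mapping.single 0 a"

definition Var :: "nat \<Rightarrow> 'k::comm_ring_1 mpoly" where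
  "Var i = Poly_Mapping.single (Poly_Mapping.single i 1) 1"

definition polys :: "nat \<Rightarrow> 'k::comm_ring_1 mpoly set" where
  "polys n = {p. \<forall>m\<in>Poly_Mapping.keys p. Poly_Mapping.keys m \<subseteq> {..<n}}"

definition mono_degree :: "(nat \<Rightarrow>\<^sub>0 nat) \<Rightarrow> nat" where
  "mono_degree m = (\<Sum>i\<in>Poly_Mapping.keys m. Poly_Mapping.lookup m i)"

definition polys_le :: "nat \<Rightarrow> nat \<Rightarrow> 'k::comm_ring_1 mpoly set" where
  "polys_le n d = {p \<in> polys n. \<forall>m\<in>Poly_Mapping.keys p. mono_degree m \<le> d}"

text \<open>
  The value of a polynomial at the point s of a commutative ring, its coefficients being sent
  to that ring by c. With c the identity this is evaluation, with c = Const it is substitution.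
\<close>

definition mono_eval :: "(nat \<Rightarrow> 'r) \<Rightarrow> (nat \<Rightarrow>\<^sub>0 nat) \<Rightarrow> 'r::comm_ring_1" where
  "mono_eval s m = (\<Prod>i\<in>Poly_Mapping.keys m. s i ^ Poly_Mapping.lookup m i)"

definition poly_eval ::
  "('k \<Rightarrow> 'r) \<Rightarrow> (nat \<Rightarrow> 'r) \<Rightarrow> 'k::comm_ring_1 mpoly \<Rightarrow> 'r::comm_ring_1" where
  "poly_eval c s p = (\<Sum>m\<in>Poly_Mapping.keys p. c (Poly_Mapping.lookup p m) * mono_eval s m)"

definition ratfuns :: "nat \<Rightarrow> 'k::field mpoly fract set" where
  "ratfuns n = {Fract p q | p q. p \<in> polys n \<and> q \<in> polys n \<and> q \<noteq> 0}"

definition of_poly :: "'k::field mpoly \<Rightarrow> 'k mpoly fract" where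
  "of_poly p = Fract p 1"

definition field_span :: "'f set \<Rightarrow> 'f set \<Rightarrow> 'f::field set" where
  "field_span L S =
     {\<Sum>a\<in>A. c a * a | A c. finite A \<and> A \<subseteq> S \<and> (\<forall>a\<in>A. c a \<in> L)}"

text \<open>The subfield of the field of rational functions generated over the constants by S.\<close>

definition field_adjoin :: "'k::field mpoly fract set \<Rightarrow> 'k mpoly fract set" where
  "field_adjoin S = generate_field ring_of_type_algebra (of_poly ` range Const \<union> S)"


section \<open>Representations and their invariants\<close>

text \<open>
  V is the whole type of vectors, with a chosen ordered basis bs. The coordinate functions of bs
  freely generate the symmetric algebra of the dual space; the i-th one is the variable i.
\<close>

locale fin_dim_representation =
  vector_space scale + group_action G "UNIV :: 'v set" \<rho>
  for scale :: "'k::field \<Rightarrow> 'v::ab_group_add \<Rightarrow> 'v"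
    and G :: "('g, 'm) monoid_scheme" (structure)
    and \<rho> :: "'g \<Rightarrow> 'v \<Rightarrow> 'v" +
  fixes bs :: "'v list"
  assumes linear_rep: "g \<in> carrier G \<Longrightarrow> Vector_Spaces.linear scale scale (\<rho> g)"
    and distinct_basis: "distinct bs"
    and independent_basis: "independent (set bs)"
    and span_basis: "span (set bs) = UNIV"
begin

abbreviation vdim :: nat where
  "vdim \<equiv> length bs"

definition coord :: "nat \<Rightarrow> 'v \<Rightarrow> 'k" where
  "coord i v = representation (set bs) v (bs ! i)"

definition linear_form :: "('v \<Rightarrow> 'k) \<Rightarrow> 'k mpoly" where
  "linear_form l = (\<Sum>j<vdim. Const (l (bs ! j)) * Var j)"

text \<open>
  The action of g on polynomials is the algebra homomorphism extending the action on linear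
  forms, (g l)(v) = l(g^-1 v). It is extended to fractions by g (p/q) = (g p)/(g q); see
  ract_Fract below.
\<close>

definition pact :: "'g \<Rightarrow> 'k mpoly \<Rightarrow> 'k mpoly" where
  "pact g = poly_eval Const (\<lambda>i. linear_form (\<lambda>v. coord i (\<rho> (inv g) v)))"

definition ract :: "'g \<Rightarrow> 'k mpoly fract \<Rightarrow> 'k mpoly fract" where
  "ract g f = (THE h. \<exists>p q. p \<in> polys vdim \<and> q \<in> polys vdim \<and> q \<noteq> 0 \<and>
                 f = Fract p q \<and> h = Fract (pact g p) (pact g q))"

definition inv_polys_le :: "nat \<Rightarrow> 'k mpoly set" where
  "inv_polys_le d = {p \<in> polys_le vdim d. \<forall>g\<in>carrier G. pact g p = p}"

definition inv_ratfuns :: "'k mpoly fract set" where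
  "inv_ratfuns = {f \<in> ratfuns vdim. \<forall>g\<in>carrier G. ract g f = f}"

definition beta_field :: nat where
  "beta_field = (LEAST d. field_adjoin (of_poly ` inv_polys_le d) = inv_ratfuns)"

definition D_span :: nat where
  "D_span = (LEAST d. field_span inv_ratfuns (of_poly ` polys_le vdim d) = ratfuns vdim)"

end

locale faithful_fin_dim_representation =
  fin_dim_representation scale G \<rho> bs + faithful_action G "UNIV :: 'v set" \<rho>
  for scale :: "'k::field \<Rightarrow> 'v::ab_group_add \<Rightarrow> 'v"
    and G :: "('g, 'm) monoid_scheme" (structure)
    and \<rho> :: "'g \<Rightarrow> 'v \<Rightarrow> 'v"
    and bs :: "'v list"


section \<open>The action is well defined\<close>

lemma mono_eval_superset:
  "finite A \<Longrightarrow> Poly_Mapping.keys m \<subseteq> A \<Longrightarrow> mono_eval s m = (\<Prod>i\<in>A. s i ^ Poly_Mapping.lookup m i)"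
  unfolding mono_eval_def by (rule prod.mono_neutral_left) (auto simp: in_keys_iff)

lemma mono_eval_add: "mono_eval s (m + m') = mono_eval s m * mono_eval s m'"
proof -
  let ?A = "Poly_Mapping.keys m \<union> Poly_Mapping.keys m'"
  have "Poly_Mapping.keys (m + m') \<subseteq> ?A" by (rule keys_add)
  then show ?thesis
    by (simp add: mono_eval_superset[of ?A] lookup_add power_add prod.distrib)
qed

lemma mono_eval_0 [simp]: "mono_eval s 0 = 1"
  by (simp add: mono_eval_def)

locale coeff_hom =
  fixes c :: "'k::comm_ring_1 \<Rightarrow> 'r::comm_ring_1"
  assumes c_add: "c (a + b) = c a + c b" and c_mult: "c (a * b) = c a * c b" and c_1: "c 1 = 1"
begin

lemma c_0: "c 0 = 0"
  using c_add[of 0 0] by simp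

lemma poly_eval_superset:
  "finite A \<Longrightarrow> Poly_Mapping.keys p \<subseteq> A \<Longrightarrow> poly_eval c s p = (\<Sum>m\<in>A. c (Poly_Mapping.lookup p m) * mono_eval s m)"
  unfolding poly_eval_def by (rule sum.mono_neutral_left) (auto simp: in_keys_iff c_0)

lemma poly_eval_0 [simp]: "poly_eval c s 0 = 0"
  by (simp add: poly_eval_def)

lemma poly_eval_add: "poly_eval c s (p + q) = poly_eval c s p + poly_eval c s q"
proof -
  let ?A = "Poly_Mapping.keys p \<union> Poly_Mapping.keys q"
  have "Poly_Mapping.keys (p + q) \<subseteq> ?A" by (rule keys_add)
  then show ?thesis
    by (simp add: poly_eval_superset[of ?A] lookup_add c_add distrib_right sum.distrib)
qed

lemma poly_eval_sum: "poly_eval c s (sum f A) = (\<Sum>a\<in>A. poly_eval c s (f a))"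
  by (induction A rule: infinite_finite_induct) (simp_all add: poly_eval_add)

lemma poly_eval_single: "poly_eval c s (Poly_Mapping.single m a) = c a * mono_eval s m"
  by (cases "a = 0") (simp_all add: poly_eval_def c_0)

lemma poly_eval_Const [simp]: "poly_eval c s (Const a) = c a"
  by (simp add: Const_def poly_eval_single)

lemma poly_eval_1 [simp]: "poly_eval c s 1 = 1"
  using poly_eval_Const[of s 1] by (simp add: Const_def c_1)

lemma poly_eval_Var [simp]: "poly_eval c s (Var i) = s i"
  by (simp add: Var_def poly_eval_single c_1 mono_eval_def)

end

lemma mpoly_expand: "p = (\<Sum>m\<in>Poly_Mapping.keys p. Poly_Mapping.single m (Poly_Mapping.lookup p m))"
  by (rule poly_mapping_eqI)
    (auto simp: lookup_sum lookup_single when_def sum.If_cases if_distrib in_keys_iff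
      cong: if_cong)

context coeff_hom begin

lemma poly_eval_mult: "poly_eval c s (p * q) = poly_eval c s p * poly_eval c s q"
proof -
  have "poly_eval c s (p * q) =
      poly_eval c s ((\<Sum>m\<in>Poly_Mapping.keys p. Poly_Mapping.single m (Poly_Mapping.lookup p m)) *
        (\<Sum>m\<in>Poly_Mapping.keys q. Poly_Mapping.single m (Poly_Mapping.lookup q m)))"
    by (subst (1) mpoly_expand[of p], subst (1) mpoly_expand[of q]) (rule refl)
  also have "\<dots> = (\<Sum>m\<in>Poly_Mapping.keys p. \<Sum>m'\<in>Poly_Mapping.keys q.
      (c (Poly_Mapping.lookup p m) * mono_eval s m) * (c (Poly_Mapping.lookup q m') * mono_eval s m'))"
    unfolding sum_product poly_eval_sum mult_single poly_eval_single c_mult mono_eval_add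
    by (simp add: mult_ac)
  also have "\<dots> = poly_eval c s p * poly_eval c s q"
    by (simp add: poly_eval_def sum_product)
  finally show ?thesis .
qed

lemma poly_eval_power: "poly_eval c s (p ^ n) = poly_eval c s p ^ n"
  by (induction n) (simp_all add: poly_eval_mult)

lemma poly_eval_prod: "poly_eval c s (prod f A) = (\<Prod>a\<in>A. poly_eval c s (f a))"
  by (induction A rule: infinite_finite_induct) (simp_all add: poly_eval_mult)

lemma poly_eval_subst:
  "poly_eval c s (poly_eval Const t p) = poly_eval c (\<lambda>i. poly_eval c s (t i)) p"
proof -
  have "poly_eval c s (mono_eval t m) = mono_eval (\<lambda>i. poly_eval c s (t i)) m" for m
    by (simp add: mono_eval_def poly_eval_prod poly_eval_power)
  then show ?thesis
    by (simp add: poly_eval_def[of Const] poly_eval_sum poly_eval_mult)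
      (simp add: poly_eval_def)
qed

end

interpretation Const_hom: coeff_hom Const
  by unfold_locales
    (simp_all add: Const_def single_add mult_single flip: single_one)

lemma Const_sum: "Const (sum f A) = (\<Sum>a\<in>A. Const (f a))"
  by (induction A rule: infinite_finite_induct) (simp_all add: Const_hom.c_add Const_hom.c_0)

interpretation id_hom: coeff_hom "\<lambda>a. a"
  by unfold_locales simp_all

lemma Var_power: "Var i ^ e = Poly_Mapping.single (Poly_Mapping.single i e) (1::'k::comm_ring_1)"
  by (induction e) (simp_all add: Var_def mult_single flip: single_add single_one)

lemma mono_eval_Var: "mono_eval Var m = Poly_Mapping.single m (1::'k::comm_ring_1)"
proof -
  have "(\<Prod>i\<in>A. Poly_Mapping.single (g i) (1::'k)) = Poly_Mapping.single (\<Sum>i\<in>A. g i) 1"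
    for A and g :: "nat \<Rightarrow> nat \<Rightarrow>\<^sub>0 nat"
    by (induction A rule: infinite_finite_induct) (simp_all add: mult_single flip: single_one)
  then have "mono_eval Var m =
      Poly_Mapping.single (\<Sum>i\<in>Poly_Mapping.keys m. Poly_Mapping.single i (Poly_Mapping.lookup m i)) (1::'k)"
    by (simp add: mono_eval_def Var_power)
  moreover have "(\<Sum>i\<in>Poly_Mapping.keys m. Poly_Mapping.single i (Poly_Mapping.lookup m i)) = m"
    by (rule poly_mapping_eqI)
      (auto simp: lookup_sum lookup_single when_def in_keys_iff cong: if_cong)
  ultimately show ?thesis by simp
qed

lemma poly_eval_Const_id:
  assumes "p \<in> polys n" and "\<And>i. i < n \<Longrightarrow> s i = Var i"
  shows "poly_eval Const s p = p"
proof -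
  have "mono_eval s m = mono_eval Var m" if "m \<in> Poly_Mapping.keys p" for m
    using assms that unfolding mono_eval_def polys_def by (intro prod.cong) fastforce+
  then have "poly_eval Const s p = (\<Sum>m\<in>Poly_Mapping.keys p. Poly_Mapping.single m (Poly_Mapping.lookup p m))"
    by (simp add: poly_eval_def mono_eval_Var Const_def mult_single)
  then show ?thesis using mpoly_expand[of p] by simp
qed

context fin_dim_representation
begin

lemma group_G: "group G"
  using group_hom group_hom.axioms(1) by blast

lemma rep_mult: "g \<in> carrier G \<Longrightarrow> h \<in> carrier G \<Longrightarrow> \<rho> (g \<otimes> h) v = \<rho> g (\<rho> h v)"
  by (rule composition_rule) auto

lemma rep_one: "\<rho> \<one> v = v"
  using id_eq_one by (metis UNIV_I restrict_apply')

lemma linear_coord: "Vector_Spaces.linear scale (*) (coord i)"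
  unfolding coord_def using linear_representation[OF independent_basis span_basis] .

lemma coord_basis: "i < vdim \<Longrightarrow> j < vdim \<Longrightarrow> coord i (bs ! j) = (if i = j then 1 else 0)"
  using distinct_basis
  by (auto simp: coord_def representation_basis[OF independent_basis] nth_eq_iff_index_eq)

lemma coord_expand: "(\<Sum>j<vdim. scale (coord j v) (bs ! j)) = v"
proof -
  have "(\<Sum>j<vdim. scale (coord j v) (bs ! j)) =
      (\<Sum>b\<in>set bs. scale (representation (set bs) v b) b)"
    unfolding coord_def
    by (rule sum.reindex_bij_betw[OF bij_betw_nth[OF distinct_basis]]) simp_all
  also have "\<dots> = v"
    by (rule sum_representation_eq[OF independent_basis]) (simp_all add: span_basis)
  finally show ?thesis .
qed

lemma linear_form_coord: "i < vdim \<Longrightarrow> linear_form (coord i) = Var i"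
proof -
  assume i: "i < vdim"
  have "linear_form (coord i) = (\<Sum>j<vdim. if i = j then Var j else 0)"
    unfolding linear_form_def using i
    by (intro sum.cong refl) (simp add: coord_basis Const_hom.c_0 Const_hom.c_1)
  with i show ?thesis by simp
qed

text \<open>A linear form, evaluated at the coordinates of a vector, is the linear functional itself.\<close>

lemma eval_linear_form:
  assumes "Vector_Spaces.linear scale (*) l"
  shows "poly_eval (\<lambda>a. a) (\<lambda>i. coord i v) (linear_form l) = l v"
proof -
  interpret l: Vector_Spaces.linear scale "(*)" l by fact
  have "poly_eval (\<lambda>a. a) (\<lambda>i. coord i v) (linear_form l) = (\<Sum>j<vdim. coord j v * l (bs ! j))"
    by (simp add: linear_form_def id_hom.poly_eval_sum id_hom.poly_eval_mult mult.commute)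
  also have "\<dots> = l (\<Sum>j<vdim. scale (coord j v) (bs ! j))"
    by (simp add: l.sum l.scale)
  finally show ?thesis by (simp add: coord_expand)
qed

lemma linear_functional_rep:
  assumes "Vector_Spaces.linear scale (*) l" and "g \<in> carrier G"
  shows "Vector_Spaces.linear scale (*) (\<lambda>v. l (\<rho> g v))"
  using Vector_Spaces.linear_compose[OF linear_rep[OF assms(2)] assms(1)] by (simp add: o_def)

lemma pact_eval:
  assumes "g \<in> carrier G"
  shows "poly_eval (\<lambda>a. a) (\<lambda>i. coord i v) (pact g p) =
         poly_eval (\<lambda>a. a) (\<lambda>i. coord i (\<rho> (inv g) v)) p"
  using assms group.inv_closed[OF group_G]
  by (simp add: pact_def id_hom.poly_eval_subst eval_linear_form linear_functional_rep linear_coord)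

lemma pact_linear_form:
  assumes "Vector_Spaces.linear scale (*) l" and g: "g \<in> carrier G"
  shows "pact g (linear_form l) = linear_form (\<lambda>v. l (\<rho> (inv g) v))"
proof -
  interpret l: Vector_Spaces.linear scale "(*)" l by fact
  have *: "l w = (\<Sum>j<vdim. l (bs ! j) * coord j w)" for w
  proof -
    have "l w = l (\<Sum>j<vdim. scale (coord j w) (bs ! j))"
      by (simp only: coord_expand)
    also have "\<dots> = (\<Sum>j<vdim. l (bs ! j) * coord j w)"
      by (simp add: l.sum l.scale mult.commute)
    finally show ?thesis .
  qed
  have "pact g (linear_form l) =
      (\<Sum>j<vdim. Const (l (bs ! j)) * linear_form (\<lambda>v. coord j (\<rho> (inv g) v)))"
    by (simp add: pact_def linear_form_def[of l] Const_hom.poly_eval_sum Const_hom.poly_eval_mult)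
  also have "\<dots> = (\<Sum>i<vdim. \<Sum>j<vdim.
      Const (l (bs ! j)) * (Const (coord j (\<rho> (inv g) (bs ! i))) * Var i))"
    unfolding linear_form_def sum_distrib_left by (rule sum.swap)
  also have "\<dots> = (\<Sum>i<vdim. Const (l (\<rho> (inv g) (bs ! i))) * Var i)"
  proof (rule sum.cong[OF refl])
    fix i
    define w where "w = \<rho> (inv g) (bs ! i)"
    have "Const (l w) = (\<Sum>j<vdim. Const (l (bs ! j)) * Const (coord j w))"
      by (subst *) (simp add: Const_sum Const_hom.c_mult)
    then show "(\<Sum>j<vdim. Const (l (bs ! j)) * (Const (coord j (\<rho> (inv g) (bs ! i))) * Var i)) =
        Const (l (\<rho> (inv g) (bs ! i))) * Var i"
      by (simp add: sum_distrib_right mult.assoc flip: w_def)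
  qed
  finally show ?thesis by (simp add: linear_form_def)
qed

lemma pact_pact:
  assumes g: "g \<in> carrier G" and h: "h \<in> carrier G"
  shows "pact g (pact h p) = pact (g \<otimes> h) p"
proof -
  interpret group G by (rule group_G)
  have "pact g (linear_form (\<lambda>v. coord i (\<rho> (inv h) v))) =
      linear_form (\<lambda>v. coord i (\<rho> (inv (g \<otimes> h)) v))" for i
    using g h
    by (simp add: pact_linear_form linear_functional_rep linear_coord inv_mult_group rep_mult)
  then have "poly_eval Const (\<lambda>i. linear_form (\<lambda>v. coord i (\<rho> (inv g) v)))
        (linear_form (\<lambda>v. coord i (\<rho> (inv h) v))) =
      linear_form (\<lambda>v. coord i (\<rho> (inv (g \<otimes> h)) v))" for i
    by (simp add: pact_def)
  then show ?thesis
    by (simp add: pact_def Const_hom.poly_eval_subst)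
qed

lemma pact_one: "p \<in> polys vdim \<Longrightarrow> pact \<one> p = p"
  unfolding pact_def
  by (erule poly_eval_Const_id)
    (simp add: group.is_monoid[OF group_G] monoid.inv_one rep_one linear_form_coord)

lemma pact_mult: "pact g (p * q) = pact g p * pact g q"
  by (simp add: pact_def Const_hom.poly_eval_mult)

lemma pact_eq_0_iff:
  assumes g: "g \<in> carrier G" and p: "p \<in> polys vdim"
  shows "pact g p = 0 \<longleftrightarrow> p = 0"
proof -
  interpret group G by (rule group_G)
  have "pact (inv g) (pact g p) = p"
    using g p by (simp add: pact_pact pact_one)
  moreover have "pact h 0 = 0" for h
    by (simp add: pact_def)
  ultimately show ?thesis by metis
qed

lemma ract_Fract:
  assumes g: "g \<in> carrier G" and p: "p \<in> polys vdim" and q: "q \<in> polys vdim" "q \<noteq> 0"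
  shows "ract g (Fract p q) = Fract (pact g p) (pact g q)"
  unfolding ract_def
proof (rule the_equality)
  show "\<exists>p' q'. p' \<in> polys vdim \<and> q' \<in> polys vdim \<and> q' \<noteq> 0 \<and> Fract p q = Fract p' q' \<and>
      Fract (pact g p) (pact g q) = Fract (pact g p') (pact g q')"
    using p q by (intro exI[of _ p] exI[of _ q]) simp
next
  fix h
  assume "\<exists>p' q'. p' \<in> polys vdim \<and> q' \<in> polys vdim \<and> q' \<noteq> 0 \<and> Fract p q = Fract p' q' \<and>
      h = Fract (pact g p') (pact g q')"
  then obtain p' q' where q': "q' \<in> polys vdim" "q' \<noteq> 0" and eq: "Fract p q = Fract p' q'"
    and h: "h = Fract (pact g p') (pact g q')" by blast
  from eq q q' have "p * q' = p' * q" by (simp add: eq_fract)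
  then have "pact g p * pact g q' = pact g p' * pact g q"
    by (metis pact_mult)
  then show "h = Fract (pact g p) (pact g q)"
    using q q' g by (simp add: h eq_fract pact_eq_0_iff)
qed

end

end

(* Write D for the spanning degree, L for the field of rational functions, K for its subfield of
   invariants and F for the subfield generated by the invariants of degree at most 2 D + 1.
   A polynomial h of degree at most D + 1 is a K-combination of polynomials f_j of degree at most D.
   Pairing with all polynomials s of degree at most D under the trace form gives the linear system
   Tr(h s) = sum_j c_j Tr(f_j s), whose entries lie in F, so it also has a solution in F. The trace
   form is nondegenerate because Tr(1) = |G| is invertible; hence that solution expresses h as an
   F-combination of polynomials of degree at most D. So the F-span of these polynomials is closed
   under multiplication by variables and contains all polynomials. Taking traces of such an
   expansion shows that every invariant polynomial lies in F, and K consists of quotients of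
   invariant polynomials. *)

theory Submission
  imports Defs
begin

section \<open>Polynomials of bounded degree\<close>

lemma mono_degree_superset:
  "finite A \<Longrightarrow> Poly_Mapping.keys m \<subseteq> A \<Longrightarrow> mono_degree m = (\<Sum>i\<in>A. Poly_Mapping.lookup m i)"
  unfolding mono_degree_def by (rule sum.mono_neutral_left) (auto simp: in_keys_iff)

lemma mono_degree_add: "mono_degree (m + m') = mono_degree m + mono_degree m'"
proof -
  let ?A = "Poly_Mapping.keys m \<union> Poly_Mapping.keys m'"
  have "Poly_Mapping.keys (m + m') \<subseteq> ?A" by (rule keys_add)
  then show ?thesis
    by (simp add: mono_degree_superset[of ?A] lookup_add sum.distrib)
qed

lemma mono_degree_single [simp]: "mono_degree (Poly_Mapping.single i e) = e"
  by (simp add: mono_degree_def)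

lemma mono_degree_0 [simp]: "mono_degree 0 = 0"
  by (simp add: mono_degree_def)

lemma polys_le_subset: "polys_le n d \<subseteq> polys n"
  by (auto simp: polys_le_def)

lemma polys_le_mono: "d \<le> e \<Longrightarrow> polys_le n d \<subseteq> polys_le n e"
  by (auto simp: polys_le_def)

lemma polys_le_single:
  "Poly_Mapping.keys m \<subseteq> {..<n} \<Longrightarrow> mono_degree m \<le> d \<Longrightarrow> Poly_Mapping.single m a \<in> polys_le n d"
  by (auto simp: polys_le_def polys_def)

lemma polys_le_add: "p \<in> polys_le n d \<Longrightarrow> q \<in> polys_le n d \<Longrightarrow> p + q \<in> polys_le n d"
  using keys_add[of p q] unfolding polys_le_def polys_def by blast

lemma polys_le_mult:
  assumes "p \<in> polys_le n d" "q \<in> polys_le n e"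
  shows "p * q \<in> polys_le n (d + e)"
proof -
  have "Poly_Mapping.keys r \<subseteq> {..<n} \<and> mono_degree r \<le> d + e" if r: "r \<in> Poly_Mapping.keys (p * q)" for r
  proof -
    obtain a b where "r = a + b" "a \<in> Poly_Mapping.keys p" "b \<in> Poly_Mapping.keys q"
      using r keys_mult[of p q] by blast
    then show ?thesis
      using assms keys_add[of a b]
      by (auto simp: polys_le_def polys_def mono_degree_add intro!: add_mono) blast+
  qed
  then show ?thesis by (auto simp: polys_le_def polys_def)
qed

lemma polys_le_0: "0 \<in> polys_le n d"
  by (simp add: polys_le_def polys_def)

lemma polys_le_1: "1 \<in> polys_le n d"
  using polys_le_single[of 0 n d 1] by simp

lemma polys_le_Const: "Const a \<in> polys_le n d"
  by (simp add: Const_def polys_le_single)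

lemma polys_le_Var: "i < n \<Longrightarrow> Var i \<in> polys_le n 1"
  by (simp add: Var_def polys_le_single)

lemma polys_le_sum: "(\<And>a. a \<in> A \<Longrightarrow> f a \<in> polys_le n d) \<Longrightarrow> sum f A \<in> polys_le n d"
  by (induction A rule: infinite_finite_induct) (auto simp: polys_le_0 polys_le_add)

lemma polys_le_power: "p \<in> polys_le n d \<Longrightarrow> p ^ e \<in> polys_le n (e * d)"
  by (induction e) (auto simp: polys_le_1 polys_le_mult)

lemma polys_le_prod:
  "(\<And>a. a \<in> A \<Longrightarrow> f a \<in> polys_le n (d a)) \<Longrightarrow> prod f A \<in> polys_le n (sum d A)"
  by (induction A rule: infinite_finite_induct) (auto simp: polys_le_1 polys_le_mult)

text \<open>A monomial of degree \<open>e\<close> becomes a product of \<open>e\<close> polynomials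
  of degree at most 1. Applied to linear forms, this is why the group action does not raise
  degrees.\<close>

lemma polys_le_linear_subst:
  assumes "p \<in> polys_le n d" and s: "\<And>i. s i \<in> polys_le n' 1"
  shows "poly_eval Const s p \<in> polys_le n' d"
  unfolding poly_eval_def
proof (rule polys_le_sum)
  fix m assume "m \<in> Poly_Mapping.keys p"
  then have m: "mono_degree m \<le> d" using assms by (auto simp: polys_le_def)
  have "mono_eval s m \<in> polys_le n' (mono_degree m)"
    unfolding mono_eval_def mono_degree_def
    by (intro polys_le_prod) (use polys_le_power[OF s] in simp)
  then have "Const (Poly_Mapping.lookup p m) * mono_eval s m \<in> polys_le n' (0 + mono_degree m)"
    by (intro polys_le_mult polys_le_Const)
  then show "Const (Poly_Mapping.lookup p m) * mono_eval s m \<in> polys_le n' d"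
    using polys_le_mono[OF m] by auto
qed

lemma polys_Union_le: "polys n = (\<Union>d. polys_le n d :: 'a::comm_ring_1 mpoly set)"
proof
  show "polys n \<subseteq> (\<Union>d. polys_le n d :: 'a mpoly set)"
  proof
    fix p :: "'a mpoly" assume "p \<in> polys n"
    \<comment> \<open>The sum of all monomial degrees is a crude bound that also covers the zero
      polynomial.\<close>
    then have "p \<in> polys_le n (\<Sum>m\<in>Poly_Mapping.keys p. mono_degree m)"
      by (auto simp: polys_le_def intro!: member_le_sum)
    then show "p \<in> (\<Union>d. polys_le n d)" by blast
  qed
qed (use polys_le_subset in blast)

lemma polys_linear_subst:
  "p \<in> polys n \<Longrightarrow> (\<And>i. s i \<in> polys_le n' 1) \<Longrightarrow> poly_eval Const s p \<in> polys n'"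
  unfolding polys_Union_le using polys_le_linear_subst by blast

lemma polys_mult: "p \<in> polys n \<Longrightarrow> q \<in> polys n \<Longrightarrow> p * q \<in> polys n"
  unfolding polys_Union_le using polys_le_mult by blast

lemma polys_add: "p \<in> polys n \<Longrightarrow> q \<in> polys n \<Longrightarrow> p + q \<in> polys n"
  using keys_add[of p q] unfolding polys_def by blast

lemma polys_0: "0 \<in> polys n" and polys_1: "1 \<in> polys n" and polys_Const: "Const a \<in> polys n"
  using polys_le_0 polys_le_1 polys_le_Const polys_le_subset by blast+

lemma polys_Var: "i < n \<Longrightarrow> Var i \<in> polys n"
  using polys_le_Var polys_le_subset by blast

lemma polys_uminus: "p \<in> polys n \<Longrightarrow> - p \<in> polys n"
  by (simp add: polys_def)

lemma polys_sum: "(\<And>a. a \<in> A \<Longrightarrow> f a \<in> polys n) \<Longrightarrow> sum f A \<in> polys n"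
  by (induction A rule: infinite_finite_induct) (auto simp: polys_0 polys_add)

lemma polys_prod: "(\<And>a. a \<in> A \<Longrightarrow> f a \<in> polys n) \<Longrightarrow> prod f A \<in> polys n"
  by (induction A rule: infinite_finite_induct) (auto simp: polys_1 polys_mult)

text \<open>Substituting each variable for itself writes a polynomial as a sum of products of
  constants and variables with index below \<open>n\<close>. This later reduces a closure statement
  to multiplication by a single variable.\<close>

lemma polys_induct [consumes 1, case_names Const Var add mult]:
  assumes p: "p \<in> polys n"
    and C: "\<And>a. P (Const a)" and V: "\<And>i. i < n \<Longrightarrow> P (Var i)"
    and add: "\<And>p q. P p \<Longrightarrow> P q \<Longrightarrow> P (p + q)" and mult: "\<And>p q. P p \<Longrightarrow> P q \<Longrightarrow> P (p * q)"
  shows "P p"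
proof -
  have 0: "P 0" and 1: "P 1" using C[of 0] C[of 1] by (simp_all add: Const_def)
  have sum: "P (sum f A)" if "\<And>a. a \<in> A \<Longrightarrow> P (f a)" for A :: "(nat \<Rightarrow>\<^sub>0 nat) set" and f
    using that by (induction A rule: infinite_finite_induct) (auto simp: 0 add)
  have prod: "P (prod f A)" if "\<And>a. a \<in> A \<Longrightarrow> P (f a)" for A :: "nat set" and f
    using that by (induction A rule: infinite_finite_induct) (auto simp: 1 mult)
  have pow: "P (q ^ e)" if "P q" for q e
    using that by (induction e) (auto simp: 1 mult)
  have "P (poly_eval Const Var p)"
    unfolding poly_eval_def mono_eval_def
    using p by (intro sum mult C prod pow V) (auto simp: polys_def)
  then show ?thesis using poly_eval_Const_id[OF p, of Var] by simp
qed


section \<open>Subfields, spans and linear systems\<close>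

lemma of_poly_0 [simp]: "of_poly 0 = 0" and of_poly_1 [simp]: "of_poly 1 = 1"
  by (simp_all add: of_poly_def fract_collapse)

lemma of_poly_add: "of_poly (p + q) = of_poly p + of_poly q"
  and of_poly_mult: "of_poly (p * q) = of_poly p * of_poly q"
  by (simp_all add: of_poly_def)

lemma of_poly_sum: "of_poly (sum f A) = (\<Sum>a\<in>A. of_poly (f a))"
  by (induction A rule: infinite_finite_induct) (simp_all add: of_poly_add)

lemma of_poly_eq_iff [simp]: "of_poly p = of_poly q \<longleftrightarrow> p = q"
  by (simp add: of_poly_def eq_fract)

lemma Fract_eq_of_poly_divide: "Fract p q = of_poly p / of_poly q"
  by (simp add: of_poly_def)

text \<open>A set inside a field type, so that several subfields can live in one type. Since
  \<open>inverse 0 = 0\<close>, closure under inverses can be stated without an exception at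
  zero.\<close>

locale type_subfield =
  fixes F :: "'f::field set"
  assumes one_mem: "1 \<in> F" and uminus_mem: "a \<in> F \<Longrightarrow> - a \<in> F"
    and inverse_mem: "a \<in> F \<Longrightarrow> inverse a \<in> F"
    and add_mem: "a \<in> F \<Longrightarrow> b \<in> F \<Longrightarrow> a + b \<in> F"
    and mult_mem: "a \<in> F \<Longrightarrow> b \<in> F \<Longrightarrow> a * b \<in> F"
begin

lemma zero_mem: "0 \<in> F"
  using add_mem[OF one_mem uminus_mem[OF one_mem]] by simp

lemma diff_mem: "a \<in> F \<Longrightarrow> b \<in> F \<Longrightarrow> a - b \<in> F"
  using add_mem[of a "- b"] uminus_mem by simp

lemma divide_mem: "a \<in> F \<Longrightarrow> b \<in> F \<Longrightarrow> a / b \<in> F"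
  by (simp add: divide_inverse mult_mem inverse_mem)

lemma sum_mem: "(\<And>i. i \<in> A \<Longrightarrow> f i \<in> F) \<Longrightarrow> sum f A \<in> F"
  by (induction A rule: infinite_finite_induct) (auto simp: zero_mem add_mem)

lemma field_span_base: "s \<in> S \<Longrightarrow> s \<in> field_span F S"
  unfolding field_span_def
  by (intro CollectI exI[of _ "{s}"] exI[of _ "\<lambda>_. 1"]) (auto simp: one_mem)

lemma field_span_0: "0 \<in> field_span F S"
  unfolding field_span_def by (intro CollectI exI[of _ "{}"]) auto

lemma field_span_scale:
  assumes "c \<in> F" "v \<in> field_span F S"
  shows "c * v \<in> field_span F S"
proof -
  obtain A d where "v = (\<Sum>a\<in>A. d a * a)" "finite A" "A \<subseteq> S" "\<forall>a\<in>A. d a \<in> F"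
    using assms by (auto simp: field_span_def)
  then show ?thesis using assms(1) unfolding field_span_def
    by (intro CollectI exI[of _ A] exI[of _ "\<lambda>a. c * d a"])
       (auto simp: mult_mem sum_distrib_left mult.assoc)
qed

lemma field_span_add:
  assumes "v \<in> field_span F S" "w \<in> field_span F S"
  shows "v + w \<in> field_span F S"
proof -
  obtain A c where A: "v = (\<Sum>a\<in>A. c a * a)" "finite A" "A \<subseteq> S" "\<forall>a\<in>A. c a \<in> F"
    using assms(1) by (auto simp: field_span_def)
  obtain B d where B: "w = (\<Sum>a\<in>B. d a * a)" "finite B" "B \<subseteq> S" "\<forall>a\<in>B. d a \<in> F"
    using assms(2) by (auto simp: field_span_def)
  \<comment> \<open>The supports may overlap; extending both coefficient families by 0 puts them on
    the common index set \<open>A \<union> B\<close>.\<close>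
  let ?c = "\<lambda>a. if a \<in> A then c a else 0" and ?d = "\<lambda>a. if a \<in> B then d a else 0"
  have "v = (\<Sum>a\<in>A \<union> B. ?c a * a)" "w = (\<Sum>a\<in>A \<union> B. ?d a * a)"
    unfolding A B using A(2) B(2) by (auto intro!: sum.mono_neutral_cong_left)
  then have "v + w = (\<Sum>a\<in>A \<union> B. (?c a + ?d a) * a)"
    by (simp add: distrib_right sum.distrib)
  then show ?thesis unfolding field_span_def using A B
    by (intro CollectI exI[of _ "A \<union> B"] exI[of _ "\<lambda>a. ?c a + ?d a"])
       (auto simp: add_mem zero_mem)
qed

lemma field_span_sum:
  "(\<And>i. i \<in> A \<Longrightarrow> f i \<in> field_span F S) \<Longrightarrow> sum f A \<in> field_span F S"
  by (induction A rule: infinite_finite_induct) (auto simp: field_span_0 field_span_add)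

text \<open>
  Gaussian elimination: the equations may be infinite in number, since only the unknowns are
  eliminated.
\<close>

lemma linear_system_solvable:
  assumes "finite J"
    and "\<And>i j. i \<in> I \<Longrightarrow> j \<in> J \<Longrightarrow> a i j \<in> F" and "\<And>i. i \<in> I \<Longrightarrow> b i \<in> F"
    and "\<And>i. i \<in> I \<Longrightarrow> (\<Sum>j\<in>J. c j * a i j) = b i"
  shows "\<exists>c'. (\<forall>j\<in>J. c' j \<in> F) \<and> (\<forall>i\<in>I. (\<Sum>j\<in>J. c' j * a i j) = b i)"
  using assms
\<comment> \<open>The solution \<open>c\<close> over the whole field stays fixed while the matrix
  and the right-hand side vary. It also solves each reduced system, which supplies the solvability
  hypothesis for the smaller set of unknowns.\<close>
proof (induction J arbitrary: a b rule: finite_induct)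
  case empty
  then show ?case by simp
next
  case (insert k J)
  note a = insert.prems(1) and b = insert.prems(2) and eq = insert.prems(3)
  show ?case
  proof (cases "\<forall>i\<in>I. a i k = 0")
    case True
    have "(\<Sum>j\<in>J. c j * a i j) = b i" if "i \<in> I" for i
      using eq[OF that] True that insert.hyps by simp
    then obtain c' where c': "\<forall>j\<in>J. c' j \<in> F" "\<forall>i\<in>I. (\<Sum>j\<in>J. c' j * a i j) = b i"
      using insert.IH[of a b] a b by blast
    \<comment> \<open>Unknown \<open>k\<close> occurs in no equation, so any value in
      \<open>F\<close> will do; 0 is chosen.\<close>
    have "(\<Sum>j\<in>J. (c'(k := 0)) j * a i j) = (\<Sum>j\<in>J. c' j * a i j)" for i
      using insert.hyps by (intro sum.cong) auto
    then show ?thesis using c' insert.hyps True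
      by (intro exI[of _ "c'(k := 0)"]) (auto simp: zero_mem)
  next
    case False
    then obtain l where l: "l \<in> I" "a l k \<noteq> 0" by blast
    \<comment> \<open>Row \<open>l\<close> is the pivot: subtracting \<open>a i k / a l k\<close>
      times it cancels unknown \<open>k\<close> in every row.\<close>
    define a' where "a' i j = a i j - a l j * (a i k / a l k)" for i j
    define b' where "b' i = b i - b l * (a i k / a l k)" for i
    have split: "(\<Sum>j\<in>J. d j * a' i j) =
        (\<Sum>j\<in>J. d j * a i j) - (\<Sum>j\<in>J. d j * a l j) * (a i k / a l k)" for d i
      by (simp add: a'_def right_diff_distrib sum_subtractf sum_distrib_right sum_divide_distrib mult.assoc)
    have sum_J: "(\<Sum>j\<in>J. c j * a i j) = b i - c k * a i k" if "i \<in> I" for i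
      using eq[OF that] insert.hyps by (simp add: algebra_simps)
    have "(\<Sum>j\<in>J. c j * a' i j) = b' i" if "i \<in> I" for i
      unfolding split b'_def sum_J[OF that] sum_J[OF l(1)] using l by (simp add: field_simps)
    moreover have "a' i j \<in> F" if "i \<in> I" "j \<in> J" for i j
      unfolding a'_def using a that l by (intro diff_mem mult_mem divide_mem) auto
    moreover have "b' i \<in> F" if "i \<in> I" for i
      unfolding b'_def using a b that l by (intro diff_mem mult_mem divide_mem) auto
    ultimately obtain c' where c': "\<forall>j\<in>J. c' j \<in> F" "\<forall>i\<in>I. (\<Sum>j\<in>J. c' j * a' i j) = b' i"
      using insert.IH[of a' b'] by blast
    \<comment> \<open>Back substitution: \<open>e\<close> is the value of unknown \<open>k\<close>
      forced by the pivot row.\<close>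
    define e where "e = (b l - (\<Sum>j\<in>J. c' j * a l j)) / a l k"
    have "e \<in> F"
      unfolding e_def using a b c' l by (intro diff_mem divide_mem sum_mem mult_mem) auto
    moreover have "(\<Sum>j\<in>insert k J. (c'(k := e)) j * a i j) = b i" if i: "i \<in> I" for i
    proof -
      have "(\<Sum>j\<in>J. (c'(k := e)) j * a i j) = (\<Sum>j\<in>J. c' j * a i j)"
        using insert.hyps by (intro sum.cong) auto
      moreover have "(\<Sum>j\<in>J. c' j * a i j) = b' i + (\<Sum>j\<in>J. c' j * a l j) * (a i k / a l k)"
        using c'(2) i split[of c' i] by (simp add: algebra_simps)
      ultimately have "(\<Sum>j\<in>insert k J. (c'(k := e)) j * a i j) =
          e * a i k + (b' i + (\<Sum>j\<in>J. c' j * a l j) * (a i k / a l k))"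
        unfolding sum.insert[OF insert.hyps] by simp
      also have "\<dots> = b i" using l(2) by (simp add: b'_def e_def field_simps)
      finally show ?thesis .
    qed
    ultimately show ?thesis using c'(1) by (intro exI[of _ "c'(k := e)"]) auto
  qed
qed

end

text \<open>\<open>field_adjoin\<close> is built from the record-based
  \<open>generate_field\<close>; these equations carry its closure rules over to the type class
  operations. The last one assumes \<open>a \<noteq> 0\<close> because the record inverse of 0 is
  unspecified.\<close>

lemma ring_of_type_algebra_simps:
  fixes a b :: "'f::field"
  defines "R \<equiv> (ring_of_type_algebra :: 'f ring)"
  shows "carrier R = UNIV" "\<one>\<^bsub>R\<^esub> = 1" "\<zero>\<^bsub>R\<^esub> = 0" "a \<oplus>\<^bsub>R\<^esub> b = a + b" "a \<otimes>\<^bsub>R\<^esub> b = a * b"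
    "\<ominus>\<^bsub>R\<^esub> a = - a" "a \<noteq> 0 \<Longrightarrow> inv\<^bsub>R\<^esub> a = inverse a"
proof -
  interpret field R unfolding R_def by (rule field_from_type_algebra)
  show *: "carrier R = UNIV" "\<one>\<^bsub>R\<^esub> = 1" "\<zero>\<^bsub>R\<^esub> = 0" "x \<oplus>\<^bsub>R\<^esub> y = x + y" "x \<otimes>\<^bsub>R\<^esub> y = x * y" for x y
    by (simp_all add: R_def ring_of_type_algebra_def)
  show "\<ominus>\<^bsub>R\<^esub> a = - a" by (rule minus_equality) (simp_all add: *)
  show "inv\<^bsub>R\<^esub> a = inverse a" if "a \<noteq> 0" by (rule inv_char) (simp_all add: * that)
qed

lemma type_subfield_field_adjoin:
  "type_subfield (field_adjoin S :: 'a::field mpoly fract set)"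
proof
  let ?R = "ring_of_type_algebra :: 'a mpoly fract ring"
  note R = ring_of_type_algebra_simps and gf = generate_field.intros[where R = ?R]
  fix a b :: "'a mpoly fract"
  show "1 \<in> field_adjoin S" unfolding field_adjoin_def using gf(1) by (simp add: R)
  assume a: "a \<in> field_adjoin S"
  show "- a \<in> field_adjoin S"
    using gf(3)[OF a[unfolded field_adjoin_def]] by (simp add: R field_adjoin_def)
  show "inverse a \<in> field_adjoin S"
    using gf(4)[OF a[unfolded field_adjoin_def]] a by (cases "a = 0") (simp_all add: R field_adjoin_def)
  assume b: "b \<in> field_adjoin S"
  show "a + b \<in> field_adjoin S"
    using gf(5)[OF a[unfolded field_adjoin_def] b[unfolded field_adjoin_def]]
    by (simp add: R field_adjoin_def)
  show "a * b \<in> field_adjoin S"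
    using gf(6)[OF a[unfolded field_adjoin_def] b[unfolded field_adjoin_def]]
    by (simp add: R field_adjoin_def)
qed

lemma field_adjoin_superset: "S \<subseteq> field_adjoin S"
  and field_adjoin_Const: "of_poly (Const a) \<in> field_adjoin S"
  unfolding field_adjoin_def by (auto intro: generate_field.incl)

lemma field_adjoin_least:
  assumes "type_subfield K" and "\<And>a. of_poly (Const a) \<in> K" and "S \<subseteq> K"
  shows "field_adjoin S \<subseteq> K"
proof
  interpret type_subfield K by fact
  fix f assume "f \<in> field_adjoin S"
  then show "f \<in> K" unfolding field_adjoin_def
    by (induction rule: generate_field.induct)
       (use assms in \<open>auto simp: ring_of_type_algebra_simps one_mem uminus_mem inverse_mem add_mem mult_mem\<close>)
qed

section \<open>The action on polynomials and rational functions\<close>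

lemma ratfunsI: "p \<in> polys n \<Longrightarrow> q \<in> polys n \<Longrightarrow> q \<noteq> 0 \<Longrightarrow> Fract p q \<in> ratfuns n"
  by (auto simp: ratfuns_def)

lemma type_subfield_ratfuns: "type_subfield (ratfuns n :: 'k::field mpoly fract set)"
proof
  fix a b :: "'k mpoly fract"
  show "1 \<in> ratfuns n"
    using polys_1[of n] unfolding ratfuns_def One_fract_def by force
  assume "a \<in> ratfuns n"
  then obtain p q where a: "a = Fract p q" "p \<in> polys n" "q \<in> polys n" "q \<noteq> 0"
    by (auto simp: ratfuns_def)
  show "- a \<in> ratfuns n"
    using a polys_uminus[OF a(2)] unfolding ratfuns_def by auto
  show "inverse a \<in> ratfuns n"
  proof (cases "p = 0")
    case True
    then have "inverse a = Fract 0 1" using a by (simp add: fract_collapse)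
    then show ?thesis using ratfunsI[OF polys_0 polys_1] by simp
  next
    case False
    then show ?thesis using a unfolding ratfuns_def by auto
  qed
  assume "b \<in> ratfuns n"
  then obtain r s where b: "b = Fract r s" "r \<in> polys n" "s \<in> polys n" "s \<noteq> 0"
    by (auto simp: ratfuns_def)
  have "a + b = Fract (p * s + r * q) (q * s)" using a b by simp
  then show "a + b \<in> ratfuns n"
    using a b unfolding ratfuns_def by (auto intro!: polys_add polys_mult exI)
  have "a * b = Fract (p * r) (q * s)" using a b by simp
  then show "a * b \<in> ratfuns n"
    using a b unfolding ratfuns_def by (auto intro!: polys_mult exI)
qed

lemma of_poly_in_ratfuns: "p \<in> polys n \<Longrightarrow> of_poly p \<in> ratfuns n"
  using polys_1[of n] unfolding ratfuns_def of_poly_def by force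

context fin_dim_representation
begin

interpretation group G by (rule group_G)

lemma pact_add: "pact g (p + q) = pact g p + pact g q"
  by (simp add: pact_def Const_hom.poly_eval_add)

lemma pact_0 [simp]: "pact g 0 = 0" and pact_1 [simp]: "pact g 1 = 1"
  and pact_Const [simp]: "pact g (Const a) = Const a"
  by (simp_all add: pact_def)

lemma pact_uminus: "pact g (- p) = - pact g p"
  using pact_add[of g p "- p"] by (simp add: eq_neg_iff_add_eq_0 add.commute)

lemma pact_sum: "pact g (sum f A) = (\<Sum>a\<in>A. pact g (f a))"
  by (simp add: pact_def Const_hom.poly_eval_sum)

lemma pact_prod: "pact g (prod f A) = (\<Prod>a\<in>A. pact g (f a))"
  by (simp add: pact_def Const_hom.poly_eval_prod)

lemma linear_form_polys_le: "linear_form l \<in> polys_le vdim 1"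
  unfolding linear_form_def
proof (rule polys_le_sum)
  fix j assume "j \<in> {..<vdim}"
  then have "Const (l (bs ! j)) * Var j \<in> polys_le vdim (0 + 1)"
    by (intro polys_le_mult polys_le_Const polys_le_Var) simp
  then show "Const (l (bs ! j)) * Var j \<in> polys_le vdim 1" by simp
qed

lemma pact_polys_le: "p \<in> polys_le vdim d \<Longrightarrow> pact g p \<in> polys_le vdim d"
  unfolding pact_def by (rule polys_le_linear_subst[OF _ linear_form_polys_le])

lemma pact_polys: "p \<in> polys vdim \<Longrightarrow> pact g p \<in> polys vdim"
  unfolding pact_def by (rule polys_linear_subst[OF _ linear_form_polys_le])

lemma ratfuns_cases:
  assumes "f \<in> ratfuns vdim"
  obtains p q where "f = Fract p q" "p \<in> polys vdim" "q \<in> polys vdim" "q \<noteq> 0"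
    "\<And>g. g \<in> carrier G \<Longrightarrow> ract g f = Fract (pact g p) (pact g q)"
    "\<And>g. g \<in> carrier G \<Longrightarrow> pact g q \<noteq> 0"
  using assms ract_Fract pact_eq_0_iff unfolding ratfuns_def by blast

lemma ract_of_poly: "g \<in> carrier G \<Longrightarrow> p \<in> polys vdim \<Longrightarrow> ract g (of_poly p) = of_poly (pact g p)"
  unfolding of_poly_def by (simp add: ract_Fract polys_1)

lemma ract_1: "g \<in> carrier G \<Longrightarrow> ract g 1 = 1"
  using ract_of_poly[OF _ polys_1] by simp

lemma ract_0: "g \<in> carrier G \<Longrightarrow> ract g 0 = 0"
  using ract_of_poly[OF _ polys_0] by simp

lemma ract_add:
  assumes g: "g \<in> carrier G" and "f \<in> ratfuns vdim" "h \<in> ratfuns vdim"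
  shows "ract g (f + h) = ract g f + ract g h"
proof -
  obtain p q where f: "f = Fract p q" "p \<in> polys vdim" "q \<in> polys vdim" "q \<noteq> 0"
    "ract g f = Fract (pact g p) (pact g q)" "pact g q \<noteq> 0"
    using ratfuns_cases[OF assms(2)] g by metis
  obtain r s where h: "h = Fract r s" "r \<in> polys vdim" "s \<in> polys vdim" "s \<noteq> 0"
    "ract g h = Fract (pact g r) (pact g s)" "pact g s \<noteq> 0"
    using ratfuns_cases[OF assms(3)] g by metis
  have "ract g (Fract (p * s + r * q) (q * s)) =
      Fract (pact g (p * s + r * q)) (pact g (q * s))"
    using f h g by (intro ract_Fract polys_add polys_mult) auto
  then show ?thesis using f h by (simp add: pact_add pact_mult)
qed

lemma ract_mult:
  assumes g: "g \<in> carrier G" and "f \<in> ratfuns vdim" "h \<in> ratfuns vdim"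
  shows "ract g (f * h) = ract g f * ract g h"
proof -
  obtain p q where f: "f = Fract p q" "p \<in> polys vdim" "q \<in> polys vdim" "q \<noteq> 0"
    "ract g f = Fract (pact g p) (pact g q)"
    using ratfuns_cases[OF assms(2)] g by metis
  obtain r s where h: "h = Fract r s" "r \<in> polys vdim" "s \<in> polys vdim" "s \<noteq> 0"
    "ract g h = Fract (pact g r) (pact g s)"
    using ratfuns_cases[OF assms(3)] g by metis
  have "ract g (Fract (p * r) (q * s)) = Fract (pact g (p * r)) (pact g (q * s))"
    using f h g by (intro ract_Fract polys_mult) auto
  then show ?thesis using f h by (simp add: pact_mult)
qed

lemma type_subfield_inv_ratfuns: "type_subfield inv_ratfuns"
proof
  interpret R: type_subfield "ratfuns vdim :: 'k mpoly fract set" by (rule type_subfield_ratfuns)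
  fix a b :: "'k mpoly fract"
  show "1 \<in> inv_ratfuns" by (simp add: inv_ratfuns_def R.one_mem ract_1)
  assume "a \<in> inv_ratfuns"
  then have a: "a \<in> ratfuns vdim" "\<And>g. g \<in> carrier G \<Longrightarrow> ract g a = a"
    by (auto simp: inv_ratfuns_def)
  have "ract g (- a) = - a" if g: "g \<in> carrier G" for g
    using ract_add[OF g a(1) R.uminus_mem[OF a(1)]] a(2)[OF g] ract_0[OF g]
    by (simp add: eq_neg_iff_add_eq_0 add.commute)
  then show "- a \<in> inv_ratfuns" using a by (simp add: inv_ratfuns_def R.uminus_mem)
  have "ract g (inverse a) = inverse a" if g: "g \<in> carrier G" for g
  proof (cases "a = 0")
    case False
    then show ?thesis
      using ract_mult[OF g a(1) R.inverse_mem[OF a(1)]] a(2)[OF g] ract_1[OF g]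
      by (simp add: field_simps)
  qed (simp add: ract_0 g)
  then show "inverse a \<in> inv_ratfuns" using a by (simp add: inv_ratfuns_def R.inverse_mem)
  assume "b \<in> inv_ratfuns"
  then have b: "b \<in> ratfuns vdim" "\<And>g. g \<in> carrier G \<Longrightarrow> ract g b = b"
    by (auto simp: inv_ratfuns_def)
  show "a + b \<in> inv_ratfuns" using a b by (simp add: inv_ratfuns_def R.add_mem ract_add)
  show "a * b \<in> inv_ratfuns" using a b by (simp add: inv_ratfuns_def R.mult_mem ract_mult)
qed

lemma inv_ratfuns_subset: "inv_ratfuns \<subseteq> ratfuns vdim"
  by (auto simp: inv_ratfuns_def)

lemma of_poly_inv_ratfuns:
  "p \<in> polys vdim \<Longrightarrow> (\<And>g. g \<in> carrier G \<Longrightarrow> pact g p = p) \<Longrightarrow> of_poly p \<in> inv_ratfuns"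
  by (simp add: inv_ratfuns_def of_poly_in_ratfuns ract_of_poly)

text \<open>Left translation permutes the group, with translation by the inverse undoing it. Hence
  sums and products over all conjugates are invariant.\<close>

lemma bij_betw_translate: "h \<in> carrier G \<Longrightarrow> bij_betw (\<lambda>g. h \<otimes> g) (carrier G) (carrier G)"
  by (rule bij_betw_byWitness[where f' = "\<lambda>g. inv h \<otimes> g"])
    (auto simp: m_assoc[symmetric])

end

section \<open>Traces, invariant denominators and integrality for a finite group\<close>

locale finite_representation = fin_dim_representation scale G \<rho> bs
  for scale :: "'k::field \<Rightarrow> 'v::ab_group_add \<Rightarrow> 'v"
    and G :: "('g, 'm) monoid_scheme" (structure)
    and \<rho> :: "'g \<Rightarrow> 'v \<Rightarrow> 'v"
    and bs :: "'v list" +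
  assumes finite_G: "finite (carrier G)"
begin

interpretation group G by (rule group_G)

interpretation R: type_subfield "ratfuns vdim :: 'k mpoly fract set"
  by (rule type_subfield_ratfuns)

interpretation K: type_subfield inv_ratfuns
  by (rule type_subfield_inv_ratfuns)

text \<open>For a faithful action this is the trace of the Galois extension of the rational
  functions over the invariants.\<close>

definition rtrace :: "'k mpoly fract \<Rightarrow> 'k mpoly fract" where
  "rtrace f = (\<Sum>g\<in>carrier G. ract g f)"

text \<open>The same sum on polynomials, where degrees remain visible.\<close>

definition ptrace :: "'k mpoly \<Rightarrow> 'k mpoly" where
  "ptrace p = (\<Sum>g\<in>carrier G. pact g p)"

lemma rtrace_of_poly: "p \<in> polys vdim \<Longrightarrow> rtrace (of_poly p) = of_poly (ptrace p)"
  by (simp add: rtrace_def ptrace_def of_poly_sum ract_of_poly)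

text \<open>Translation permutes the summands, and each conjugate keeps the degree bound. Traces are
  the source of invariants of controlled degree.\<close>

lemma ptrace_inv_polys_le:
  assumes "p \<in> polys_le vdim d"
  shows "ptrace p \<in> inv_polys_le d"
proof -
  have "pact h (ptrace p) = ptrace p" if h: "h \<in> carrier G" for h
  proof -
    have "pact h (ptrace p) = (\<Sum>g\<in>carrier G. pact (h \<otimes> g) p)"
      using h by (simp add: ptrace_def pact_sum pact_pact)
    also have "\<dots> = ptrace p"
      unfolding ptrace_def by (rule sum.reindex_bij_betw[OF bij_betw_translate[OF h]])
    finally show ?thesis .
  qed
  then show ?thesis using assms
    by (auto simp: inv_polys_le_def ptrace_def intro!: polys_le_sum pact_polys_le)
qed

lemma rtrace_sum:
  assumes "\<And>a. a \<in> A \<Longrightarrow> f a \<in> ratfuns vdim"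
  shows "rtrace (sum f A) = (\<Sum>a\<in>A. rtrace (f a))"
proof -
  have "ract g (sum f A) = (\<Sum>a\<in>A. ract g (f a))" if g: "g \<in> carrier G" for g
    using assms
    by (induction A rule: infinite_finite_induct) (auto simp: g ract_0 ract_add R.sum_mem)
  then show ?thesis unfolding rtrace_def by (subst sum.swap) simp
qed

lemma rtrace_add:
  "f \<in> ratfuns vdim \<Longrightarrow> h \<in> ratfuns vdim \<Longrightarrow> rtrace (f + h) = rtrace f + rtrace h"
  by (simp add: rtrace_def ract_add sum.distrib)

lemma rtrace_scale: "c \<in> inv_ratfuns \<Longrightarrow> f \<in> ratfuns vdim \<Longrightarrow> rtrace (c * f) = c * rtrace f"
  by (simp add: rtrace_def inv_ratfuns_def ract_mult sum_distrib_left)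

lemma rtrace_inv_ratfuns: "c \<in> inv_ratfuns \<Longrightarrow> rtrace c = of_nat (Coset.order G) * c"
  by (simp add: rtrace_def inv_ratfuns_def Coset.order_def)

text \<open>The denominator can be made invariant by multiplying with its other conjugates.\<close>

lemma ratfuns_invariant_denominator:
  assumes "f \<in> ratfuns vdim"
  obtains p q where "p \<in> polys vdim" "q \<in> polys vdim" "q \<noteq> 0" "f = Fract p q"
    "\<And>g. g \<in> carrier G \<Longrightarrow> pact g q = q"
proof -
  obtain p q where f: "f = Fract p q" and p: "p \<in> polys vdim" and q: "q \<in> polys vdim" "q \<noteq> 0"
    using assms by (auto simp: ratfuns_def)
  define r where "r = (\<Prod>g\<in>carrier G - {\<one>}. pact g q)"
  have N: "q * r = (\<Prod>g\<in>carrier G. pact g q)"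
    using prod.remove[OF finite_G one_closed, of "\<lambda>g. pact g q"] q by (simp add: r_def pact_one)
  have r: "r \<in> polys vdim" unfolding r_def by (intro polys_prod pact_polys q)
  have r0: "r \<noteq> 0" unfolding r_def using finite_G q by (simp add: pact_eq_0_iff)
  have "pact h (q * r) = q * r" if h: "h \<in> carrier G" for h
  proof -
    have "pact h (q * r) = (\<Prod>g\<in>carrier G. pact (h \<otimes> g) q)"
      using h by (simp add: N pact_prod pact_pact)
    also have "\<dots> = q * r"
      unfolding N by (rule prod.reindex_bij_betw[OF bij_betw_translate[OF h]])
    finally show ?thesis .
  qed
  moreover have "f = Fract (p * r) (q * r)"
    using f q r0 by (simp add: eq_fract)
  ultimately show ?thesis using that[of "p * r" "q * r"] p q r r0 by (simp add: polys_mult)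
qed

text \<open>
  Every polynomial is a root of its characteristic polynomial, the product of all X - g p over the
  group, whose coefficients are grouped by the number of factors contributing X.
\<close>

lemma polys_integral:
  assumes p: "p \<in> polys vdim"
  obtains e where "\<And>j. e j \<in> polys vdim" "\<And>j g. g \<in> carrier G \<Longrightarrow> pact g (e j) = e j"
    "p ^ Coset.order G = (\<Sum>j<Coset.order G. e j * p ^ j)"
proof -
  \<comment> \<open>\<open>B\<close> is the set of factors contributing X, and \<open>c B\<close>
    multiplies the constant terms of the other factors. The minus sign in \<open>e j\<close> below
    anticipates moving the lower terms to the other side of the equation.\<close>
  define c where "c B = (\<Prod>g\<in>carrier G - B. - pact g p)" for B
  define E where "E j = {B \<in> Pow (carrier G). card B = j}" for j
  define e where "e j = - (\<Sum>B\<in>E j. c B)" for j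
  have finE: "finite (E j)" for j unfolding E_def using finite_G by simp
  have "pact h (e j) = e j" if h: "h \<in> carrier G" for h j
  proof -
    let ?t = "\<lambda>B. (\<lambda>g. h \<otimes> g) ` B"
    note bij = bij_betw_translate[OF h]
    have c: "pact h (c B) = c (?t B)" if "B \<in> E j" for B
    proof -
      have B: "B \<subseteq> carrier G" using that by (simp add: E_def)
      have inj: "inj_on (\<lambda>g. h \<otimes> g) (carrier G - B)"
        using bij by (auto simp: bij_betw_def intro: inj_on_subset)
      have "carrier G - ?t B = ?t (carrier G - B)"
        using bij B by (simp add: bij_betw_def inj_on_image_set_diff[of _ "carrier G"])
      then have "c (?t B) = (\<Prod>g\<in>carrier G - B. - pact (h \<otimes> g) p)"
        unfolding c_def by (simp add: prod.reindex[OF inj])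
      also have "\<dots> = pact h (c B)"
        unfolding c_def pact_prod using h by (intro prod.cong) (auto simp: pact_uminus pact_pact)
      finally show ?thesis ..
    qed
    have card: "card (?t B) = card B" if "B \<subseteq> carrier G" for B
      using bij that by (auto simp: bij_betw_def intro!: card_image intro: inj_on_subset)
    have sub: "?t B \<in> Pow (carrier G)" if "B \<in> Pow (carrier G)" for B
      using bij that by (auto simp: bij_betw_def)
    have inj: "inj_on ?t (E j)"
      using bij by (auto simp: bij_betw_def E_def intro: inj_on_subset[OF inj_on_image_Pow])
    \<comment> \<open>Translation by \<open>h\<close> permutes the subsets of size \<open>j\<close>,
      as an injective self-map of a finite set is onto. So it only reorders the sum that defines
      \<open>e j\<close>.\<close>
    have "?t ` E j \<subseteq> E j" using sub card by (auto simp: E_def)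
    then have "?t ` E j = E j" by (rule endo_inj_surj[OF finE _ inj])
    then have "(\<Sum>B\<in>E j. c B) = (\<Sum>B\<in>E j. pact h (c B))"
      using sum.reindex[OF inj, of c] c by simp
    then show ?thesis unfolding e_def pact_uminus pact_sum by (rule arg_cong[OF sym])
  qed
  moreover have "e j \<in> polys vdim" for j
    unfolding e_def c_def by (intro polys_uminus polys_sum polys_prod pact_polys p)
  moreover have "p ^ Coset.order G = (\<Sum>j<Coset.order G. e j * p ^ j)"
  proof -
    \<comment> \<open>The factor at the identity vanishes; this is the characteristic polynomial
      evaluated at \<open>p\<close>.\<close>
    have "0 = (\<Prod>g\<in>carrier G. p + - pact g p)"
      using finite_G one_closed p by (auto simp: prod_zero_iff pact_one intro!: bexI[of _ \<one>])
    also have "\<dots> = (\<Sum>B\<in>Pow (carrier G). c B * p ^ card B)"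
      by (simp only: prod_add[OF finite_G] c_def prod_constant mult.commute)
    also have "\<dots> = (\<Sum>j\<in>{..Coset.order G}. \<Sum>B\<in>E j. c B * p ^ card B)"
      unfolding E_def using finite_G
      by (intro sum.group[symmetric]) (auto simp: Coset.order_def card_mono)
    also have "\<dots> = (\<Sum>j\<in>{..Coset.order G}. - e j * p ^ j)"
      by (intro sum.cong refl) (simp add: e_def sum_distrib_right E_def)
    also have "\<dots> = - e (Coset.order G) * p ^ Coset.order G - (\<Sum>j<Coset.order G. e j * p ^ j)"
      by (simp add: lessThan_Suc_atMost[symmetric] sum_negf)
    \<comment> \<open>Only the full group has this size, and its product is empty: the
      characteristic polynomial is monic.\<close>
    also have "E (Coset.order G) = {carrier G}"
      using finite_G card_subset_eq[OF finite_G] by (auto simp: E_def Coset.order_def)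
    then have "e (Coset.order G) = - 1" by (simp add: e_def c_def)
    finally show ?thesis by simp
  qed
  ultimately show ?thesis using that by blast
qed

text \<open>Integrality of the variables over the invariants lowers any exponent above the group
  order, so monomials with all exponents at most the order suffice. The bound is crude, serving only
  to show that some degree spans.\<close>

lemma polys_in_field_span:
  "p \<in> polys vdim \<Longrightarrow> of_poly p \<in> field_span inv_ratfuns (of_poly ` polys_le vdim (vdim * Coset.order G))"
  (is "_ \<Longrightarrow> _ \<in> ?W")
proof -
  let ?n = "Coset.order G"
  let ?mon = "\<lambda>m. Poly_Mapping.single m (1::'k)"
  have mon: "of_poly (?mon m) \<in> ?W" if "Poly_Mapping.keys m \<subseteq> {..<vdim}" for m
    using that
  proof (induction "mono_degree m" arbitrary: m rule: less_induct)
    case less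
    show ?case
    proof (cases "\<forall>i<vdim. Poly_Mapping.lookup m i \<le> ?n")
      case True
      then have "(\<Sum>i<vdim. Poly_Mapping.lookup m i) \<le> (\<Sum>i<vdim. ?n)" by (intro sum_mono) auto
      then have "?mon m \<in> polys_le vdim (vdim * ?n)"
        using less.prems by (intro polys_le_single) (simp_all add: mono_degree_superset[of "{..<vdim}"])
      then show ?thesis by (intro K.field_span_base) simp
    next
      case False
      then obtain i where i: "i < vdim" "?n < Poly_Mapping.lookup m i" by (auto simp: not_le)
      \<comment> \<open>Splitting off exactly the \<open>?n\<close>-th power lets the integral
        equation of \<open>Var i\<close> replace it by powers with exponent \<open>j < ?n\<close>,
        so the degree drops strictly.\<close>
      define m' where "m' = m - Poly_Mapping.single i ?n"
      have m: "m = Poly_Mapping.single i ?n + m'"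
        using i by (intro poly_mapping_eqI)
          (auto simp: m'_def lookup_add lookup_minus lookup_single when_def)
      have keys': "Poly_Mapping.keys m' \<subseteq> {..<vdim}"
        using less.prems by (auto simp: m'_def in_keys_iff lookup_minus subset_iff)
      have split: "?mon (Poly_Mapping.single i j + m') = Var i ^ j * ?mon m'" for j
        by (simp add: Var_power mult_single)
      obtain e where e: "\<And>j. e j \<in> polys vdim" "\<And>j g. g \<in> carrier G \<Longrightarrow> pact g (e j) = e j"
        "Var i ^ ?n = (\<Sum>j<?n. e j * Var i ^ j)"
        using polys_integral[OF polys_Var[OF i(1)]] by blast
      have "?mon m = (\<Sum>j<?n. e j * ?mon (Poly_Mapping.single i j + m'))"
        by (subst m) (simp add: split e(3) sum_distrib_right mult.assoc)
      then have "of_poly (?mon m) =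
          (\<Sum>j<?n. of_poly (e j) * of_poly (?mon (Poly_Mapping.single i j + m')))"
        by (simp add: of_poly_sum of_poly_mult)
      also have "\<dots> \<in> ?W"
      proof (intro K.field_span_sum K.field_span_scale)
        fix j assume "j \<in> {..<?n}"
        then show "of_poly (?mon (Poly_Mapping.single i j + m')) \<in> ?W"
          using keys' i keys_add[of "Poly_Mapping.single i j" m']
          by (intro less.hyps) (subst m, auto simp: mono_degree_add split: if_splits)
      qed (intro of_poly_inv_ratfuns e)
      finally show ?thesis .
    qed
  qed
  assume p: "p \<in> polys vdim"
  have "p = (\<Sum>m\<in>Poly_Mapping.keys p. Const (Poly_Mapping.lookup p m) * ?mon m)"
    by (subst mpoly_expand) (simp add: Const_def mult_single)
  then have "of_poly p = (\<Sum>m\<in>Poly_Mapping.keys p. of_poly (Const (Poly_Mapping.lookup p m)) * of_poly (?mon m))"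
    by (metis (no_types, lifting) of_poly_sum of_poly_mult sum.cong)
  also have "\<dots> \<in> ?W"
    using p by (intro K.field_span_sum K.field_span_scale mon of_poly_inv_ratfuns polys_Const)
      (auto simp: polys_def)
  finally show ?thesis .
qed

lemma field_span_subset_ratfuns: "field_span inv_ratfuns (of_poly ` polys_le vdim d) \<subseteq> ratfuns vdim"
  using inv_ratfuns_subset polys_le_subset[of vdim d]
  by (auto simp: field_span_def intro!: R.sum_mem R.mult_mem) (auto intro!: of_poly_in_ratfuns)

text \<open>The minimum is attained once some degree spans; \<open>vdim * Coset.order G\<close> is a
  witness. An invariant denominator makes every rational function an invariant multiple of a
  polynomial.\<close>

lemma field_span_D_span: "field_span inv_ratfuns (of_poly ` polys_le vdim D_span) = ratfuns vdim"
  unfolding D_span_def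
proof (rule LeastI, rule equalityI[OF field_span_subset_ratfuns], rule subsetI)
  fix f :: "'k mpoly fract" assume "f \<in> ratfuns vdim"
  then obtain p q where pq: "p \<in> polys vdim" "q \<in> polys vdim" "f = Fract p q"
    "\<And>g. g \<in> carrier G \<Longrightarrow> pact g q = q"
    using ratfuns_invariant_denominator by metis
  then have f: "f = inverse (of_poly q) * of_poly p"
    by (simp add: Fract_eq_of_poly_divide divide_inverse mult.commute)
  show "f \<in> field_span inv_ratfuns (of_poly ` polys_le vdim (vdim * Coset.order G))"
    unfolding f using pq(1,2,4)
    by (simp add: K.field_span_scale K.inverse_mem of_poly_inv_ratfuns polys_in_field_span)
qed

end

section \<open>Nondegeneracy of the trace form\<close>

locale nonmodular_representation = finite_representation scale G \<rho> bs
  for scale :: "'k::field \<Rightarrow> 'v::ab_group_add \<Rightarrow> 'v"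
    and G :: "('g, 'm) monoid_scheme" (structure)
    and \<rho> :: "'g \<Rightarrow> 'v \<Rightarrow> 'v"
    and bs :: "'v list" +
  assumes nonmodular: "\<not> CHAR('k) dvd Coset.order G"
begin

interpretation R: type_subfield "ratfuns vdim :: 'k mpoly fract set"
  by (rule type_subfield_ratfuns)

interpretation K: type_subfield inv_ratfuns
  by (rule type_subfield_inv_ratfuns)

text \<open>A natural number is a constant polynomial, and constants embed injectively, so it
  vanishes here only if it vanishes in the base field. In characteristic 0,
  \<open>nonmodular\<close> says that the order is not 0.\<close>

lemma of_nat_order_nonzero: "(of_nat (Coset.order G) :: 'k mpoly fract) \<noteq> 0"
proof -
  have "(of_nat n :: 'k mpoly fract) = of_poly (Const (of_nat n))" for n
    by (induction n) (simp_all add: Const_hom.c_0 Const_hom.c_add Const_hom.c_1 of_poly_add)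
  moreover have "Const (of_nat (Coset.order G)) \<noteq> (0 :: 'k mpoly)"
    using nonmodular of_nat_eq_0_iff_char_dvd[where 'a = 'k, of "Coset.order G"]
    by (metis id_hom.poly_eval_Const id_hom.poly_eval_0)
  ultimately show ?thesis by (metis of_poly_0 of_poly_eq_iff)
qed

text \<open>For nonzero \<open>a\<close>, \<open>inverse a\<close> is an invariant combination of
  low-degree polynomials \<open>s\<close>. Multiplying by \<open>a\<close> and taking traces
  expresses the trace of 1, which is the group order, through the traces of \<open>a * s\<close>, so
  it would be 0.\<close>

lemma rtrace_nondegenerate:
  assumes a: "a \<in> ratfuns vdim"
    and 0: "\<And>s. s \<in> polys_le vdim D_span \<Longrightarrow> rtrace (a * of_poly s) = 0"
  shows "a = 0"
proof (rule ccontr)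
  assume "a \<noteq> 0"
  have "inverse a \<in> field_span inv_ratfuns (of_poly ` polys_le vdim D_span)"
    using R.inverse_mem[OF a] field_span_D_span by simp
  then obtain A c where A: "inverse a = (\<Sum>s\<in>A. c s * s)" "A \<subseteq> of_poly ` polys_le vdim D_span"
    "\<forall>s\<in>A. c s \<in> inv_ratfuns"
    by (auto simp: field_span_def)
  have s: "s \<in> ratfuns vdim" if "s \<in> A" for s
    using A(2) that of_poly_in_ratfuns polys_le_subset by blast
  have "(\<Sum>s\<in>A. c s * (a * s)) = a * (\<Sum>s\<in>A. c s * s)"
    by (simp add: sum_distrib_left mult.left_commute)
  also have "\<dots> = 1" using \<open>a \<noteq> 0\<close> A(1) by (metis right_inverse)
  finally have "1 = (\<Sum>s\<in>A. c s * (a * s))" ..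
  then have "rtrace 1 = (\<Sum>s\<in>A. rtrace (c s * (a * s)))"
    using rtrace_sum[of A "\<lambda>s. c s * (a * s)"] A(3) s a inv_ratfuns_subset
    by (simp add: R.mult_mem subset_iff)
  also have "\<dots> = (\<Sum>s\<in>A. c s * rtrace (a * s))"
    using A(3) s a by (intro sum.cong) (auto simp: rtrace_scale R.mult_mem)
  also have "\<dots> = 0"
    using A(2) 0 by (intro sum.neutral) auto
  finally show False
    using rtrace_inv_ratfuns[OF K.one_mem] of_nat_order_nonzero by simp
qed

section \<open>The field generated by the invariants of degree at most
  \<open>2 * D_span + 1\<close>\<close>

definition low_field :: "'k mpoly fract set" where
  "low_field = field_adjoin (of_poly ` inv_polys_le (2 * D_span + 1))"

interpretation F: type_subfield low_field
  unfolding low_field_def by (rule type_subfield_field_adjoin)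

text \<open>Makes coefficients from \<open>low_field\<close> invariant, so that they can be pulled
  out of traces.\<close>

lemma low_field_subset: "low_field \<subseteq> inv_ratfuns"
  unfolding low_field_def
proof (rule field_adjoin_least[OF type_subfield_inv_ratfuns])
  show "of_poly (Const a) \<in> inv_ratfuns" for a
    by (simp add: of_poly_inv_ratfuns polys_Const)
  show "of_poly ` inv_polys_le (2 * D_span + 1) \<subseteq> inv_ratfuns"
    using polys_le_subset by (auto simp: inv_polys_le_def intro!: of_poly_inv_ratfuns)
qed

text \<open>The trace is itself one of the generators, because it does not raise degrees.\<close>

lemma rtrace_low_field:
  assumes "p \<in> polys_le vdim (2 * D_span + 1)"
  shows "rtrace (of_poly p) \<in> low_field"
proof -
  have "p \<in> polys vdim" using assms polys_le_subset by blast
  then have "rtrace (of_poly p) \<in> of_poly ` inv_polys_le (2 * D_span + 1)"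
    using ptrace_inv_polys_le[OF assms] by (simp only: rtrace_of_poly imageI)
  then show ?thesis
    unfolding low_field_def using field_adjoin_superset by blast
qed

text \<open>Pairing an expansion over the invariants with low-degree test polynomials gives a linear
  system over \<open>low_field\<close>. A solution there yields an element with the same pairings as
  \<open>h\<close>, hence equal to it by nondegeneracy. Degree \<open>D_span + 1\<close> leaves room
  for one extra variable as a factor.\<close>

lemma polys_le_in_low_span:
  assumes h: "h \<in> polys_le vdim (D_span + 1)"
  shows "of_poly h \<in> field_span low_field (of_poly ` polys_le vdim D_span)"
proof -
  let ?S = "polys_le vdim D_span :: 'k mpoly set"
  have poly: "p \<in> polys vdim" if "p \<in> polys_le vdim d" for p :: "'k mpoly" and d
    using that polys_le_subset by blast
  have hR: "of_poly h \<in> ratfuns vdim"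
    using h by (intro of_poly_in_ratfuns poly)
  then have "of_poly h \<in> field_span inv_ratfuns (of_poly ` ?S)"
    by (simp add: field_span_D_span)
  then obtain A c where A: "of_poly h = (\<Sum>s\<in>A. c s * s)" "finite A" "A \<subseteq> of_poly ` ?S"
    "\<forall>s\<in>A. c s \<in> inv_ratfuns"
    by (auto simp: field_span_def)
  have AR: "s \<in> ratfuns vdim" if "s \<in> A" for s
    using A(3) that of_poly_in_ratfuns poly by blast
  have SR: "of_poly t \<in> ratfuns vdim" if "t \<in> ?S" for t
    using that of_poly_in_ratfuns poly by blast
  \<comment> \<open>Stated for arbitrary invariant coefficients because it serves both the given
    \<open>c\<close> and the later \<open>d\<close>.\<close>
  have expand: "rtrace ((\<Sum>s\<in>A. d s * s) * of_poly t) = (\<Sum>s\<in>A. d s * rtrace (s * of_poly t))"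
    if "\<forall>s\<in>A. d s \<in> inv_ratfuns" "t \<in> ?S" for d t
  proof -
    have "rtrace ((\<Sum>s\<in>A. d s * s) * of_poly t) = rtrace (\<Sum>s\<in>A. d s * (s * of_poly t))"
      by (simp add: sum_distrib_right mult.assoc)
    also have "\<dots> = (\<Sum>s\<in>A. rtrace (d s * (s * of_poly t)))"
      using that AR SR inv_ratfuns_subset by (intro rtrace_sum R.mult_mem) auto
    also have "\<dots> = (\<Sum>s\<in>A. d s * rtrace (s * of_poly t))"
      using that AR SR by (intro sum.cong) (auto simp: rtrace_scale R.mult_mem)
    finally show ?thesis .
  qed
  have "rtrace (s * of_poly t) \<in> low_field" if s: "s \<in> A" and t: "t \<in> ?S" for s t
  proof -
    obtain p where p: "s = of_poly p" "p \<in> ?S" using A(3) s by blast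
    have "p * t \<in> polys_le vdim (2 * D_span + 1)"
      using polys_le_mult[OF p(2) t] polys_le_mono[of "D_span + D_span" "2 * D_span + 1" vdim]
      by auto
    then show ?thesis using rtrace_low_field[of "p * t"] p by (simp add: of_poly_mult)
  qed
  moreover have "rtrace (of_poly h * of_poly t) \<in> low_field" if "t \<in> ?S" for t
  proof -
    \<comment> \<open>The total degree \<open>(D_span + 1) + D_span\<close> is where the bound
      \<open>2 * D_span + 1\<close> comes from.\<close>
    have "h * t \<in> polys_le vdim (2 * D_span + 1)"
      using polys_le_mult[OF h that] by (simp add: mult_2)
    then show ?thesis using rtrace_low_field[of "h * t"] by (simp add: of_poly_mult)
  qed
  moreover have "(\<Sum>s\<in>A. c s * rtrace (s * of_poly t)) = rtrace (of_poly h * of_poly t)"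
    if "t \<in> ?S" for t
    using expand[OF A(4) that] A(1) by simp
  ultimately obtain d where d: "\<forall>s\<in>A. d s \<in> low_field"
    "\<forall>t\<in>?S. (\<Sum>s\<in>A. d s * rtrace (s * of_poly t)) = rtrace (of_poly h * of_poly t)"
    using F.linear_system_solvable[of A ?S "\<lambda>t s. rtrace (s * of_poly t)"
      "\<lambda>t. rtrace (of_poly h * of_poly t)" c] A(2) by blast
  \<comment> \<open>\<open>A\<close> may be linearly dependent, so \<open>d\<close> need not agree
    with \<open>c\<close>; only the sums are compared.\<close>
  define w where "w = (\<Sum>s\<in>A. d s * s)"
  have dK: "\<forall>s\<in>A. d s \<in> inv_ratfuns" using d(1) low_field_subset by blast
  then have wR: "w \<in> ratfuns vdim"
    unfolding w_def using AR inv_ratfuns_subset by (intro R.sum_mem R.mult_mem) auto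
  have "of_poly h - w = 0"
  proof (rule rtrace_nondegenerate)
    show "of_poly h - w \<in> ratfuns vdim" using hR wR by (rule R.diff_mem)
    fix t assume t: "t \<in> ?S"
    have "rtrace (of_poly h * of_poly t) =
        rtrace ((of_poly h - w) * of_poly t) + rtrace (w * of_poly t)"
      using rtrace_add[of "(of_poly h - w) * of_poly t" "w * of_poly t"] hR wR SR[OF t]
      by (simp add: algebra_simps R.mult_mem R.diff_mem)
    then show "rtrace ((of_poly h - w) * of_poly t) = 0"
      using expand[OF dK t] d(2) t by (simp add: w_def)
  qed
  moreover have "w \<in> field_span low_field (of_poly ` ?S)"
    unfolding w_def field_span_def using A d(1) by blast
  ultimately show ?thesis by simp
qed

text \<open>The induction proves that multiplication by \<open>p\<close> preserves the span, a
  stronger claim for which the product case is just composition. Applying it to 1 recovers the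
  statement.\<close>

lemma polys_in_low_span:
  assumes "p \<in> polys vdim"
  shows "of_poly p \<in> field_span low_field (of_poly ` polys_le vdim D_span)" (is "_ \<in> ?W")
proof -
  have "\<forall>w\<in>?W. of_poly p * w \<in> ?W"
    using assms
  proof (induction p rule: polys_induct)
    case (Const a)
    have "of_poly (Const a) \<in> low_field"
      unfolding low_field_def by (rule field_adjoin_Const)
    then show ?case by (simp add: F.field_span_scale)
  next
    case (Var i)
    show ?case
    proof
      fix w assume "w \<in> ?W"
      then obtain A c where A: "w = (\<Sum>s\<in>A. c s * s)" "A \<subseteq> of_poly ` polys_le vdim D_span"
        "\<forall>s\<in>A. c s \<in> low_field"
        by (auto simp: field_span_def)
      have "of_poly (Var i) * s \<in> ?W" if "s \<in> A" for s
      proof -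
        obtain q where q: "s = of_poly q" "q \<in> polys_le vdim D_span" using A(2) \<open>s \<in> A\<close> by blast
        have "Var i * q \<in> polys_le vdim (D_span + 1)"
          using polys_le_mult[OF polys_le_Var[OF Var] q(2)] by simp
        then show ?thesis using polys_le_in_low_span[of "Var i * q"] q by (simp add: of_poly_mult)
      qed
      then have "(\<Sum>s\<in>A. c s * (of_poly (Var i) * s)) \<in> ?W"
        using A(3) F.field_span_scale by (intro F.field_span_sum) blast
      then show "of_poly (Var i) * w \<in> ?W"
        by (simp add: A(1) sum_distrib_left mult.left_commute)
    qed
  next
    case (add p q)
    then show ?case by (simp add: of_poly_add distrib_right F.field_span_add)
  next
    case (mult p q)
    then show ?case by (simp add: of_poly_mult mult.assoc)
  qed
  \<comment> \<open>1 has degree 0, so it lies in the span even if \<open>D_span\<close> is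
    0.\<close>
  moreover have "of_poly 1 \<in> ?W"
    by (intro F.field_span_base imageI polys_le_1)
  ultimately show ?thesis by fastforce
qed

text \<open>Averaging an expansion of an invariant replaces each basis element by its trace.\<close>

lemma invariant_polys_in_low_field:
  assumes p: "p \<in> polys vdim" and inv: "\<And>g. g \<in> carrier G \<Longrightarrow> pact g p = p"
  shows "of_poly p \<in> low_field"
proof -
  obtain A c where A: "of_poly p = (\<Sum>s\<in>A. c s * s)" "A \<subseteq> of_poly ` polys_le vdim D_span"
    "\<forall>s\<in>A. c s \<in> low_field"
    using polys_in_low_span[OF p] by (auto simp: field_span_def)
  have cK: "c s \<in> inv_ratfuns" "s \<in> ratfuns vdim" if "s \<in> A" for s
    using A(2,3) that low_field_subset of_poly_in_ratfuns polys_le_subset by blast+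
  have tr: "rtrace s \<in> low_field" if s: "s \<in> A" for s
  proof -
    obtain q where q: "s = of_poly q" "q \<in> polys_le vdim D_span" using A(2) s by blast
    then show ?thesis
      using rtrace_low_field[of q] polys_le_mono[of D_span "2 * D_span + 1" vdim] by auto
  qed
  \<comment> \<open>Every group element fixes \<open>p\<close>, so its trace is \<open>p\<close>
    times the group order.\<close>
  have "of_nat (Coset.order G) * of_poly p = rtrace (of_poly p)"
    using rtrace_inv_ratfuns[OF of_poly_inv_ratfuns[OF p inv]] by simp
  also have "\<dots> = (\<Sum>s\<in>A. rtrace (c s * s))"
    unfolding A(1) using cK inv_ratfuns_subset by (intro rtrace_sum R.mult_mem) auto
  also have "\<dots> = (\<Sum>s\<in>A. c s * rtrace s)"
    by (intro sum.cong) (auto simp: rtrace_scale cK)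
  also have "\<dots> \<in> low_field"
    using A(3) tr by (intro F.sum_mem F.mult_mem) auto
  finally have *: "of_nat (Coset.order G) * of_poly p \<in> low_field" .
  \<comment> \<open>A subfield contains the image of the natural numbers, so dividing by the nonzero
    group order stays in \<open>low_field\<close>.\<close>
  have "(of_nat n :: 'k mpoly fract) \<in> low_field" for n
    by (induction n) (simp_all add: F.zero_mem F.one_mem F.add_mem)
  from F.divide_mem[OF * this[of "Coset.order G"]] of_nat_order_nonzero show ?thesis by simp
qed

text \<open>An invariant rational function can be written with an invariant denominator. Its
  numerator is then invariant too, and both are polynomials already known to lie in
  \<open>low_field\<close>.\<close>

lemma low_field_eq: "low_field = inv_ratfuns"
proof
  show "inv_ratfuns \<subseteq> low_field"
  proof
    fix f assume f: "f \<in> inv_ratfuns"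
    then obtain p q where pq: "p \<in> polys vdim" "q \<in> polys vdim" "q \<noteq> 0" "f = Fract p q"
      "\<And>g. g \<in> carrier G \<Longrightarrow> pact g q = q"
      using ratfuns_invariant_denominator inv_ratfuns_subset by (metis subset_iff)
    have "pact g p = p" if g: "g \<in> carrier G" for g
      using f ract_Fract[OF g pq(1,2,3)] pq g by (simp add: inv_ratfuns_def eq_fract)
    then show "f \<in> low_field"
      using pq by (simp add: Fract_eq_of_poly_divide F.divide_mem invariant_polys_in_low_field)
  qed
qed (rule low_field_subset)

lemma beta_field_le: "beta_field \<le> 2 * D_span + 1"
  unfolding beta_field_def by (rule Least_le) (rule low_field_eq[unfolded low_field_def])

end

theorem theorem1p1:
  fixes G :: "('g, 'm) monoid_scheme"
    and scale :: "'k::field \<Rightarrow> 'v::ab_group_add \<Rightarrow> 'v"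
    and \<rho> :: "'g \<Rightarrow> 'v \<Rightarrow> 'v"
    and bs :: "'v list"
  assumes "faithful_fin_dim_representation scale G \<rho> bs"
    and "finite (carrier G)"
    and "\<not> CHAR('k) dvd Coset.order G"
  shows "fin_dim_representation.beta_field scale G \<rho> bs
           \<le> 2 * fin_dim_representation.D_span scale G \<rho> bs + 1"
proof -
  interpret nonmodular_representation scale G \<rho> bs
    using assms
    by (simp add: nonmodular_representation_def nonmodular_representation_axioms_def
        finite_representation_def finite_representation_axioms_def
        faithful_fin_dim_representation_def)
  show ?thesis by (rule beta_field_le)
qed

end
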